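(* Let $R$ be a finite-dimensional non-nilpotent solvable Leibniz algebra over a field of characteristic zero whose nilradical is (isomorphic to) $NF_n$. Then $\dim R = n+1$.
   Context: A Leibniz algebra over a field $F$ is an $F$-vector space $L$ with a bilinear bracket $[-,-]$ satisfying $[x,[y,z]] = [[x,y],z] - [[x,z],y]$ for all $x,y,z\in L$. The lower central series is $L^1=L$, $L^{k+1}=[L^k,L]$, and the derived series is $L^{[1]}=L$, $L^{[s+1]}=[L^{[s]},L^{[s]}]$. $L$ is nilpotent if $L^n=0$ for some $n$, and solvable if $L^{[m]}=0$ for some $m$. The nilradical of $L$ is its maximal nilpotent two-sided ideal. $NF_n$ denotes the $n$-dimensional null-filiform Leibniz algebra, with basis $\{e_1,\dots,e_n\}$ and multiplication $[e_i,e_1]=e_{i+1}$ for $1\le i\le n-1$, all other products of basis elements being zero. *)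

theory Defs
  imports Complex_Main
begin

locale leibniz_algebra = vector_space scale
  for scale :: "'f::field \<Rightarrow> 'a::ab_group_add \<Rightarrow> 'a" +
  fixes br :: "'a \<Rightarrow> 'a \<Rightarrow> 'a"
  assumes linear_left: "Vector_Spaces.linear scale scale (\<lambda>x. br x y)"
    and linear_right: "Vector_Spaces.linear scale scale (\<lambda>y. br x y)"
    and leibniz: "br x (br y z) = br (br x y) z - br (br x z) y"
begin

definition bracket_space :: "'a set \<Rightarrow> 'a set \<Rightarrow> 'a set" where
  "bracket_space A B = span {br a b | a b. a \<in> A \<and> b \<in> B}"

text \<open>Both series are indexed from 0: the value at \<open>k\<close> is the term usually numbered \<open>k + 1\<close>.
  They are taken of a set \<open>A\<close>, so that they apply to \<open>UNIV\<close> (the whole algebra) and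
  to an ideal regarded as an algebra in its own right.\<close>

primrec lower_central :: "'a set \<Rightarrow> nat \<Rightarrow> 'a set" where
  "lower_central A 0 = A"
| "lower_central A (Suc k) = bracket_space (lower_central A k) A"

primrec derived :: "'a set \<Rightarrow> nat \<Rightarrow> 'a set" where
  "derived A 0 = A"
| "derived A (Suc k) = bracket_space (derived A k) (derived A k)"

definition nilpotent :: "'a set \<Rightarrow> bool" where
  "nilpotent A \<longleftrightarrow> (\<exists>k. lower_central A k = {0})"

definition solvable :: "'a set \<Rightarrow> bool" where
  "solvable A \<longleftrightarrow> (\<exists>k. derived A k = {0})"

definition two_sided_ideal :: "'a set \<Rightarrow> bool" where
  "two_sided_ideal I \<longleftrightarrow> subspace I \<and> (\<forall>x\<in>I. \<forall>y. br x y \<in> I \<and> br y x \<in> I)"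

definition is_nilradical :: "'a set \<Rightarrow> bool" where
  "is_nilradical N \<longleftrightarrow> two_sided_ideal N \<and> nilpotent N \<and>
     (\<forall>I. two_sided_ideal I \<and> nilpotent I \<and> N \<subseteq> I \<longrightarrow> I = N)"

end

text \<open>The null-filiform algebra is realised on coordinate vectors: \<open>x :: nat \<Rightarrow> 'f\<close> supported on
  \<open>{1..n}\<close> stands for \<open>x 1 e\<^sub>1 + \<dots> + x n e\<^sub>n\<close>, with pointwise vector space operations. The
  bracket is the bilinear extension of the multiplication table, see \<open>NF_bracket_basis\<close>.\<close>

definition NF_carrier :: "nat \<Rightarrow> (nat \<Rightarrow> 'f::field) set" where
  "NF_carrier n = {x. \<forall>k. k \<notin> {1..n} \<longrightarrow> x k = 0}"

definition NF_bracket :: "nat \<Rightarrow> (nat \<Rightarrow> 'f::field) \<Rightarrow> (nat \<Rightarrow> 'f) \<Rightarrow> nat \<Rightarrow> 'f" where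
  "NF_bracket n x y = (\<lambda>k. if k \<in> {2..n} then x (k - 1) * y 1 else 0)"

definition NF_basis :: "nat \<Rightarrow> nat \<Rightarrow> 'f::field" where
  "NF_basis i = (\<lambda>k. if k = i then 1 else 0)"

lemma NF_bracket_basis:
  assumes "i \<in> {1..n}" "j \<in> {1..n}"
  shows "NF_bracket n (NF_basis i) (NF_basis j) =
    (if j = 1 \<and> i \<le> n - 1 then NF_basis (i + 1) else (\<lambda>k. 0 :: 'f::field))"
  using assms by (auto simp: NF_bracket_def NF_basis_def fun_eq_iff)

lemma NF_bracket_leibniz:
  "NF_bracket n x (NF_bracket n y z) =
    (\<lambda>k. NF_bracket n (NF_bracket n x y) z k - NF_bracket n (NF_bracket n x z) y k)"
  by (auto simp: NF_bracket_def fun_eq_iff)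

context leibniz_algebra
begin

definition isomorphic_to_NF :: "nat \<Rightarrow> 'a set \<Rightarrow> bool" where
  "isomorphic_to_NF n A \<longleftrightarrow> (\<exists>\<phi> :: (nat \<Rightarrow> 'f) \<Rightarrow> 'a. bij_betw \<phi> (NF_carrier n) A \<and>
     (\<forall>x\<in>NF_carrier n. \<forall>y\<in>NF_carrier n. \<phi> (\<lambda>k. x k + y k) = \<phi> x + \<phi> y) \<and>
     (\<forall>c. \<forall>x\<in>NF_carrier n. \<phi> (\<lambda>k. c * x k) = scale c (\<phi> x)) \<and>
     (\<forall>x\<in>NF_carrier n. \<forall>y\<in>NF_carrier n. \<phi> (NF_bracket n x y) = br (\<phi> x) (\<phi> y)))"

end

end

theory Submission
  imports Defs
begin

text \<open>Let \<open>K = {x. [N, x] \<subseteq> [N, N]}\<close>. By the Leibniz identity \<open>K\<close> is an ideal containing the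
  nilradical \<open>N\<close>, and right multiplication by elements of \<open>K\<close> moves each term of the lower central
  series of \<open>N\<close> into the next one. Hence an ideal \<open>D \<subseteq> K\<close> with \<open>[D, D] \<subseteq> N\<close> makes \<open>N + D\<close>
  nilpotent, so \<open>D \<subseteq> N\<close> by maximality; going backwards through the derived series of \<open>K\<close>, which is
  a series of ideals of the solvable algebra, gives \<open>K = N\<close>. For \<open>N = NF\<^sub>n\<close> the quotient
  \<open>N / [N, N]\<close> is spanned by the class of \<open>e\<^sub>1\<close>, so \<open>K\<close> is the kernel of the linear functional
  sending \<open>x\<close> to the \<open>e\<^sub>1\<close>-coordinate of \<open>[e\<^sub>1, x]\<close>; it has codimension at most 1, and not 0
  because the algebra is not nilpotent.\<close>

context leibniz_algebra
begin

section \<open>Bilinearity, bracket spaces and ideals\<close>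

lemma br_add_left: "br (x + x') y = br x y + br x' y"
  and br_scale_left: "br (scale c x) y = scale c (br x y)"
  and br_zero_left: "br 0 y = 0"
proof -
  interpret l: Vector_Spaces.linear scale scale "\<lambda>x. br x y" by (rule linear_left)
  show "br (x + x') y = br x y + br x' y" "br (scale c x) y = scale c (br x y)" "br 0 y = 0"
    by (fact l.add l.scale l.zero)+
qed

lemma br_add_right: "br x (y + y') = br x y + br x y'"
  and br_diff_right: "br x (y - y') = br x y - br x y'"
  and br_scale_right: "br x (scale c y) = scale c (br x y)"
  and br_zero_right: "br x 0 = 0"
proof -
  interpret l: Vector_Spaces.linear scale scale "\<lambda>y. br x y" by (rule linear_right)
  show "br x (y + y') = br x y + br x y'" "br x (y - y') = br x y - br x y'"
    "br x (scale c y) = scale c (br x y)" "br x 0 = 0"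
    by (fact l.add l.diff l.scale l.zero)+
qed

text \<open>The Leibniz identity, solved for a product on the left: right multiplication by
  \<open>x\<close> is a derivation.\<close>

lemma br_br_left: "br (br a b) x = br a (br b x) + br (br a x) b"
  using leibniz[of a b x] by simp

lemma subspace_bracket_space: "subspace (bracket_space A B)"
  by (simp add: bracket_space_def)

lemma br_in_bracket_space: "a \<in> A \<Longrightarrow> b \<in> B \<Longrightarrow> br a b \<in> bracket_space A B"
  unfolding bracket_space_def by (rule span_base) blast

lemma bracket_space_minimal:
  assumes "subspace S" "\<And>a b. a \<in> A \<Longrightarrow> b \<in> B \<Longrightarrow> br a b \<in> S"
  shows "bracket_space A B \<subseteq> S"
  unfolding bracket_space_def using assms by (intro span_minimal) auto

text \<open>Together with \<open>bracket_space_minimal\<close>, these preimages reduce claims about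
  all of a bracket space to claims about its generators.\<close>

lemma subspace_left_vimage: "subspace S \<Longrightarrow> subspace {a. br a x \<in> S}"
  by (auto simp: subspace_def br_add_left br_scale_left br_zero_left)

lemma subspace_right_vimage: "subspace S \<Longrightarrow> subspace {a. br x a \<in> S}"
  by (auto simp: subspace_def br_add_right br_scale_right br_zero_right)

lemma subspace_lower_central: "subspace A \<Longrightarrow> subspace (lower_central A k)"
  by (cases k) (auto simp: subspace_bracket_space)

lemma ideal_subspace: "two_sided_ideal I \<Longrightarrow> subspace I"
  and ideal_br_left: "two_sided_ideal I \<Longrightarrow> x \<in> I \<Longrightarrow> br x y \<in> I"
  and ideal_br_right: "two_sided_ideal I \<Longrightarrow> x \<in> I \<Longrightarrow> br y x \<in> I"
  by (auto simp: two_sided_ideal_def)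

text \<open>Both \<open>br (br a b) y\<close> and \<open>br y (br a b)\<close> expand by the Leibniz
  identity into products of two elements of \<open>I\<close>.\<close>

lemma ideal_bracket_space:
  assumes I: "two_sided_ideal I"
  shows "two_sided_ideal (bracket_space I I)"
proof -
  let ?S = "bracket_space I I"
  note S = subspace_bracket_space[of I I]
  have "br (br a b) y \<in> ?S" if "a \<in> I" "b \<in> I" for a b y
    unfolding br_br_left[of a b y]
    by (intro subspace_add[OF S] br_in_bracket_space ideal_br_left[OF I] that)
  then have "?S \<subseteq> {a. br a y \<in> ?S}" for y
    by (intro bracket_space_minimal subspace_left_vimage S) auto
  moreover have "br y (br a b) \<in> ?S" if "a \<in> I" "b \<in> I" for a b y
    unfolding leibniz[of y a b]
    by (intro subspace_diff[OF S] br_in_bracket_space ideal_br_right[OF I] that)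
  then have "?S \<subseteq> {a. br y a \<in> ?S}" for y
    by (intro bracket_space_minimal subspace_right_vimage S) auto
  ultimately show ?thesis
    by (auto simp: two_sided_ideal_def subspace_bracket_space)
qed

lemma ideal_derived: "two_sided_ideal I \<Longrightarrow> two_sided_ideal (derived I k)"
  by (induction k) (auto intro: ideal_bracket_space)

lemma bracket_space_mono: "A \<subseteq> A' \<Longrightarrow> B \<subseteq> B' \<Longrightarrow> bracket_space A B \<subseteq> bracket_space A' B'"
  unfolding bracket_space_def by (intro span_mono) auto

lemma derived_mono: "A \<subseteq> B \<Longrightarrow> derived A k \<subseteq> derived B k"
  by (induction k) (auto dest: bracket_space_mono)

lemma derived_subset:
  assumes "two_sided_ideal I"
  shows "derived I k \<subseteq> I"
proof (induction k)
  case (Suc k)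
  then show ?case
    using assms ideal_br_left[OF assms] unfolding derived.simps
    by (intro bracket_space_minimal ideal_subspace) auto
qed simp

lemma ideal_setsum:
  assumes "two_sided_ideal I" "two_sided_ideal J"
  shows "two_sided_ideal {x + y | x y. x \<in> I \<and> y \<in> J}"
  using assms subspace_sums[of I J]
  unfolding two_sided_ideal_def by (fastforce simp: br_add_left br_add_right)

section \<open>Elements acting trivially on N / [N, N]\<close>

definition top_annihilator :: "'a set \<Rightarrow> 'a set" where
  "top_annihilator N = {x. \<forall>a\<in>N. br a x \<in> bracket_space N N}"

text \<open>Up to sign, \<open>br a (br x y)\<close> and \<open>br a (br y x)\<close> are the same
  difference of \<open>br (br a x) y\<close> and \<open>br (br a y) x\<close>. The former is in
  \<open>bracket_space N N\<close> because that is an ideal, the latter because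
  \<open>br a y\<close> is again in \<open>N\<close>.\<close>

lemma ideal_top_annihilator:
  assumes N: "two_sided_ideal N"
  shows "two_sided_ideal (top_annihilator N)"
proof -
  note NN = ideal_bracket_space[OF N]
  have "subspace (top_annihilator N)"
    using subspace_bracket_space[of N N]
    by (auto simp: top_annihilator_def subspace_def br_add_right br_scale_right br_zero_right)
  moreover have "br a (br x y) \<in> bracket_space N N \<and> br a (br y x) \<in> bracket_space N N"
    if "x \<in> top_annihilator N" "a \<in> N" for x y a
  proof -
    have "br (br a x) y \<in> bracket_space N N" "br (br a y) x \<in> bracket_space N N"
      using that ideal_br_left[OF N] ideal_br_left[OF NN] by (auto simp: top_annihilator_def)
    then show ?thesis
      by (simp add: leibniz subspace_diff subspace_bracket_space)
  qed
  ultimately show ?thesis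
    by (auto simp: two_sided_ideal_def top_annihilator_def)
qed

lemma ideal_subset_top_annihilator: "two_sided_ideal N \<Longrightarrow> N \<subseteq> top_annihilator N"
  by (auto simp: top_annihilator_def br_in_bracket_space)

text \<open>By the Leibniz identity, multiplying by \<open>br c d\<close> on the right amounts to
  multiplying by \<open>c\<close> and \<open>d\<close> in succession, in both orders; each factor
  raises the index by one.\<close>

lemma br_lower_central_bracket_space:
  assumes "subspace N" "a \<in> lower_central N k" "b \<in> bracket_space N N"
  shows "br a b \<in> lower_central N (k + 2)"
proof -
  have S: "subspace (lower_central N (k + 2))"
    by (rule subspace_lower_central[OF assms(1)])
  have "br a (br c d) \<in> lower_central N (k + 2)" if "c \<in> N" "d \<in> N" for c d
    using that assms(2) subspace_diff[OF S]
    by (simp add: leibniz br_in_bracket_space)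
  then have "bracket_space N N \<subseteq> {b. br a b \<in> lower_central N (k + 2)}"
    by (intro bracket_space_minimal subspace_right_vimage S) auto
  then show ?thesis using assms(3) by auto
qed

text \<open>Induction along the derivation rule for \<open>x\<close>: in
  \<open>br c (br d x)\<close> the right factor is in \<open>bracket_space N N\<close> and gains two
  steps at once, while \<open>br (br c x) d\<close> gains one by induction and one from
  \<open>d\<close>.\<close>

lemma top_annihilator_shift:
  assumes N: "subspace N" and x: "x \<in> top_annihilator N"
  shows "a \<in> lower_central N k \<Longrightarrow> br a x \<in> lower_central N (Suc k)"
proof (induction k arbitrary: a)
  case 0
  then show ?case using x by (simp add: top_annihilator_def)
next
  case (Suc k)
  let ?S = "lower_central N (Suc (Suc k))"
  have S: "subspace ?S" by (rule subspace_lower_central[OF N])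
  have "br (br c d) x \<in> ?S" if c: "c \<in> lower_central N k" and d: "d \<in> N" for c d
  proof -
    have "br d x \<in> bracket_space N N" using x d by (simp add: top_annihilator_def)
    then have "br c (br d x) \<in> ?S"
      using br_lower_central_bracket_space[OF N c] by simp
    moreover have "br (br c x) d \<in> ?S"
      using br_in_bracket_space[OF Suc.IH[OF c] d] by simp
    ultimately show ?thesis unfolding br_br_left[of c d x] by (rule subspace_add[OF S])
  qed
  then have "lower_central N (Suc k) \<subseteq> {a. br a x \<in> ?S}"
    unfolding lower_central.simps(2)[of N k]
    by (intro bracket_space_minimal subspace_left_vimage S) auto
  then show ?case using Suc.prems by auto
qed

text \<open>The lower central series of \<open>I\<close> follows that of \<open>N\<close> with a
  delay of one step: it enters \<open>N\<close> by the second assumption on \<open>I\<close>, and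
  then \<open>top_annihilator_shift\<close> carries it along.\<close>

lemma nilpotent_if_bracket_space_subset:
  assumes N: "subspace N" "nilpotent N" and I: "I \<subseteq> top_annihilator N" "bracket_space I I \<subseteq> N"
  shows "nilpotent I"
proof -
  have sub: "lower_central I (Suc k) \<subseteq> lower_central N k" for k
  proof (induction k)
    case (Suc k)
    show ?case
      unfolding lower_central.simps(2)[of I "Suc k"]
    proof (intro bracket_space_minimal subspace_lower_central N(1))
      fix a b assume "a \<in> lower_central I (Suc k)" "b \<in> I"
      then show "br a b \<in> lower_central N (Suc k)"
        using Suc.IH I(1) by (intro top_annihilator_shift[OF N(1)]) auto
    qed
  qed (use I in simp)
  obtain k where "lower_central N k = {0}" using N(2) by (auto simp: nilpotent_def)
  then have "lower_central I (Suc k) \<subseteq> {0}" using sub[of k] by simp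
  moreover have "0 \<in> lower_central I (Suc k)"
    by (simp add: subspace_0 subspace_bracket_space)
  ultimately show ?thesis unfolding nilpotent_def by blast
qed

section \<open>Maximality and codimension of the nilradical\<close>

lemma ideal_subset_nilradical:
  assumes nr: "is_nilradical N" and D: "two_sided_ideal D"
    and DK: "D \<subseteq> top_annihilator N" and DD: "bracket_space D D \<subseteq> N"
  shows "D \<subseteq> N"
proof -
  have N: "two_sided_ideal N" "nilpotent N"
    and max: "\<And>I. two_sided_ideal I \<Longrightarrow> nilpotent I \<Longrightarrow> N \<subseteq> I \<Longrightarrow> I = N"
    using nr by (auto simp: is_nilradical_def)
  define I where "I = {x + y | x y. x \<in> N \<and> y \<in> D}"
  have I: "two_sided_ideal I" unfolding I_def by (rule ideal_setsum[OF N(1) D])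
  have NI: "N \<subseteq> I" unfolding I_def using subspace_0[OF ideal_subspace[OF D]] by force
  have DI: "D \<subseteq> I" unfolding I_def using subspace_0[OF ideal_subspace[OF N(1)]] by force
  have "I \<subseteq> top_annihilator N"
    unfolding I_def using DK ideal_subset_top_annihilator[OF N(1)]
      subspace_add[OF ideal_subspace[OF ideal_top_annihilator[OF N(1)]]] by auto
  moreover have "bracket_space I I \<subseteq> N"
  proof (rule bracket_space_minimal[OF ideal_subspace[OF N(1)]])
    fix a b assume "a \<in> I" "b \<in> I"
    then obtain p q r s where *: "p \<in> N" "q \<in> D" "r \<in> N" "s \<in> D" "a = p + q" "b = r + s"
      unfolding I_def by blast
    \<comment> \<open>Of the four products in \<open>br (p + q) (r + s)\<close>, only this one has
      no factor in the ideal \<open>N\<close>.\<close>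
    have "br q s \<in> N" using br_in_bracket_space[OF *(2,4)] DD by auto
    then show "br a b \<in> N"
      using * by (simp add: br_add_left br_add_right subspace_add[OF ideal_subspace[OF N(1)]]
          ideal_br_left[OF N(1)] ideal_br_right[OF N(1)])
  qed
  ultimately have "nilpotent I"
    by (rule nilpotent_if_bracket_space_subset[OF ideal_subspace[OF N(1)] N(2)])
  then show ?thesis using max[OF I _ NI] DI by simp
qed

lemma top_annihilator_nilradical:
  assumes solv: "solvable UNIV" and nr: "is_nilradical N"
  shows "top_annihilator N = N"
proof
  let ?K = "top_annihilator N"
  have N: "two_sided_ideal N" using nr by (simp add: is_nilradical_def)
  have K: "two_sided_ideal ?K" by (rule ideal_top_annihilator[OF N])
  obtain m where "derived UNIV m = {0}" using solv by (auto simp: solvable_def)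
  then have start: "derived ?K m \<subseteq> N"
    using derived_mono[of ?K UNIV m] subspace_0[OF ideal_subspace[OF N]] by auto
  have step: "derived ?K k \<subseteq> N" if "derived ?K (Suc k) \<subseteq> N" for k
    using that ideal_subset_nilradical[OF nr ideal_derived[OF K] derived_subset[OF K]] by simp
  \<comment> \<open>The induction on \<open>m\<close> descends the index: \<open>step\<close> trades
    \<open>Suc k\<close> for \<open>k\<close> until the whole of \<open>?K\<close> is
    reached.\<close>
  from start have "derived ?K 0 \<subseteq> N" by (induction m) (blast dest: step)+
  then show "?K \<subseteq> N" by simp
  show "N \<subseteq> ?K" by (rule ideal_subset_top_annihilator[OF N])
qed

lemma nilradical_codim_le_1:
  assumes solv: "solvable UNIV" and nr: "is_nilradical N"
    and e: "e \<in> N" "\<And>a. a \<in> N \<Longrightarrow> \<exists>c. \<exists>u\<in>bracket_space N N. a = scale c e + u"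
    and x: "x \<notin> N"
  shows "span (insert x N) = UNIV"
proof -
  let ?S = "bracket_space N N"
  have N: "two_sided_ideal N" using nr by (simp add: is_nilradical_def)
  note NN = ideal_bracket_space[OF N]
  \<comment> \<open>Since \<open>e\<close> spans \<open>N\<close> modulo \<open>?S\<close>,
    membership in the top annihilator, which equals \<open>N\<close>, can be tested on
    \<open>e\<close> alone.\<close>
  have in_N: "y \<in> N" if y: "br e y \<in> ?S" for y
  proof -
    have "br a y \<in> ?S" if "a \<in> N" for a
    proof -
      obtain c u where "u \<in> ?S" "a = scale c e + u" using e(2) \<open>a \<in> N\<close> by blast
      then show ?thesis
        using y by (simp add: br_add_left br_scale_left subspace_add subspace_scale
            subspace_bracket_space ideal_br_left[OF NN])
    qed
    then have "y \<in> top_annihilator N" by (simp add: top_annihilator_def)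
    then show ?thesis by (simp add: top_annihilator_nilradical[OF solv nr])
  qed
  obtain a u where a: "u \<in> ?S" "br e x = scale a e + u"
    using e(2) ideal_br_left[OF N e(1)] by blast
  have "a \<noteq> 0" using a x in_N[of x] by auto
  have "y \<in> span (insert x N)" for y
  proof -
    obtain b v where b: "v \<in> ?S" "br e y = scale b e + v"
      using e(2) ideal_br_left[OF N e(1)] by blast
    \<comment> \<open>The factor \<open>b / a\<close> cancels the multiples of \<open>e\<close>,
      leaving an element of \<open>?S\<close>.\<close>
    have "br e (y - scale (b / a) x) = v - scale (b / a) u"
      using \<open>a \<noteq> 0\<close> by (simp add: br_diff_right br_scale_right a b scale_right_distrib)
    then have "y - scale (b / a) x \<in> N"
      using a b by (intro in_N) (simp add: subspace_diff subspace_scale subspace_bracket_space)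
    then show ?thesis by (auto simp: span_insert intro: span_base)
  qed
  then show ?thesis by auto
qed

section \<open>Coordinates in the null-filiform algebra\<close>

text \<open>The support bound \<open>m\<close> varies in the induction while \<open>n\<close> stays
  fixed, because \<open>\<phi>\<close> is known to be linear only on
  \<open>NF_carrier n\<close>.\<close>

lemma NF_iso_sum:
  assumes add: "\<And>x y. x \<in> NF_carrier n \<Longrightarrow> y \<in> NF_carrier n \<Longrightarrow> \<phi> (\<lambda>k. x k + y k) = \<phi> x + \<phi> y"
    and scale: "\<And>c x. x \<in> NF_carrier n \<Longrightarrow> \<phi> (\<lambda>k. c * x k) = scale c (\<phi> x)"
    and "m \<le> n" "x \<in> NF_carrier m"
  shows "\<phi> x = (\<Sum>i = 1..m. scale (x i) (\<phi> (NF_basis i)))"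
  using assms(3,4)
proof (induction m arbitrary: x)
  case 0
  then have "x = (\<lambda>k. 0 * x k)" by (auto simp: NF_carrier_def)
  moreover have "x \<in> NF_carrier n" using 0 by (auto simp: NF_carrier_def)
  ultimately have "\<phi> x = scale 0 (\<phi> x)" using scale[of x 0] by simp
  then show ?case by simp
next
  case (Suc m)
  let ?y = "x(Suc m := 0)"
  have y: "?y \<in> NF_carrier m" "?y \<in> NF_carrier n" and b: "NF_basis (Suc m) \<in> NF_carrier n"
    using Suc.prems by (auto simp: NF_carrier_def NF_basis_def)
  have b': "(\<lambda>k. x (Suc m) * NF_basis (Suc m) k) \<in> NF_carrier n"
    using b by (auto simp: NF_carrier_def)
  have "x = (\<lambda>k. ?y k + x (Suc m) * NF_basis (Suc m) k)" by (auto simp: NF_basis_def)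
  then have "\<phi> x = \<phi> ?y + scale (x (Suc m)) (\<phi> (NF_basis (Suc m)))"
    using add[OF y(2) b'] scale[OF b] by simp
  also have "\<phi> ?y = (\<Sum>i = 1..m. scale (?y i) (\<phi> (NF_basis i)))"
    using Suc y by simp
  also have "\<dots> = (\<Sum>i = 1..m. scale (x i) (\<phi> (NF_basis i)))" by (rule sum.cong) auto
  finally show ?case by simp
qed

lemma dim_NF:
  assumes "isomorphic_to_NF n A" "subspace A"
  shows "dim A = n"
proof -
  obtain \<phi> where bij: "bij_betw \<phi> (NF_carrier n) A"
    and add: "\<And>x y. x \<in> NF_carrier n \<Longrightarrow> y \<in> NF_carrier n \<Longrightarrow> \<phi> (\<lambda>k. x k + y k) = \<phi> x + \<phi> y"
    and scale: "\<And>c x. x \<in> NF_carrier n \<Longrightarrow> \<phi> (\<lambda>k. c * x k) = scale c (\<phi> x)"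
    using assms(1) unfolding isomorphic_to_NF_def by blast
  let ?e = "\<lambda>i. \<phi> (NF_basis i)"
  have expand: "\<phi> x = (\<Sum>i = 1..n. scale (x i) (?e i))" if "x \<in> NF_carrier n" for x
    using NF_iso_sum[where \<phi> = \<phi> and m = n and n = n] add scale that by blast
  have basis: "NF_basis i \<in> NF_carrier n" if "i \<in> {1..n}" for i
    using that by (auto simp: NF_carrier_def NF_basis_def)
  have inj: "inj_on ?e {1..n}"
  proof (rule inj_onI)
    fix i j assume ij: "i \<in> {1..n}" "j \<in> {1..n}" "?e i = ?e j"
    then have "NF_basis i = (NF_basis j :: nat \<Rightarrow> 'f)"
      using bij basis by (auto simp: bij_betw_def dest: inj_onD)
    then have "NF_basis i i = (NF_basis j i :: 'f)" by simp
    then show "i = j" by (simp add: NF_basis_def split: if_splits)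
  qed
  have "independent (?e ` {1..n})"
  proof (rule independent_if_scalars_zero)
    fix f v assume f: "(\<Sum>v\<in>?e ` {1..n}. scale (f v) v) = 0" and v: "v \<in> ?e ` {1..n}"
    \<comment> \<open>The linear relation is pulled back to a coordinate vector, which injectivity
      of \<open>\<phi>\<close> forces to vanish.\<close>
    define c where "c = (\<lambda>i. if i \<in> {1..n} then f (?e i) else 0)"
    have c: "c \<in> NF_carrier n" "(\<lambda>k. 0) \<in> NF_carrier n" by (auto simp: c_def NF_carrier_def)
    have "\<phi> c = 0"
      unfolding expand[OF c(1)] using f by (simp add: sum.reindex[OF inj, simplified] c_def)
    moreover have "\<phi> (\<lambda>k. 0) = 0" by (simp add: expand[OF c(2)])
    ultimately have "c = (\<lambda>k. 0)"
      using inj_onD[OF bij_betw_imp_inj_on[OF bij] _ c] by simp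
    moreover obtain i where "i \<in> {1..n}" "v = ?e i" using v by blast
    ultimately show "f v = 0" by (auto simp: c_def dest: fun_cong[of _ _ i])
  qed simp
  moreover have "?e ` {1..n} \<subseteq> A" using bij basis by (blast dest: bij_betwE)
  moreover have "A \<subseteq> span (?e ` {1..n})"
  proof
    fix a assume "a \<in> A"
    then obtain x where "x \<in> NF_carrier n" and a: "a = \<phi> x" using bij by (auto simp: bij_betw_def)
    show "a \<in> span (?e ` {1..n})"
      unfolding a expand[OF \<open>x \<in> NF_carrier n\<close>]
      by (auto intro!: span_sum span_scale intro: span_base)
  qed
  ultimately have "dim A = card (?e ` {1..n})" by (intro dim_unique[OF _ _ _ refl])
  then show ?thesis using card_image[OF inj] by simp
qed

text \<open>The image of \<open>NF_basis 1\<close> serves as \<open>e\<close> when \<open>n\<close>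
  is positive: every later basis vector is a product of its predecessor with the first one.\<close>

lemma NF_cyclic_mod_bracket_space:
  assumes "isomorphic_to_NF n A"
  obtains e where "e \<in> A" "\<And>a. a \<in> A \<Longrightarrow> \<exists>c. \<exists>u\<in>bracket_space A A. a = scale c e + u"
proof -
  obtain \<phi> where bij: "bij_betw \<phi> (NF_carrier n) A"
    and add: "\<And>x y. x \<in> NF_carrier n \<Longrightarrow> y \<in> NF_carrier n \<Longrightarrow> \<phi> (\<lambda>k. x k + y k) = \<phi> x + \<phi> y"
    and scale: "\<And>c x. x \<in> NF_carrier n \<Longrightarrow> \<phi> (\<lambda>k. c * x k) = scale c (\<phi> x)"
    and br: "\<And>x y. x \<in> NF_carrier n \<Longrightarrow> y \<in> NF_carrier n \<Longrightarrow> \<phi> (NF_bracket n x y) = br (\<phi> x) (\<phi> y)"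
    using assms(1) unfolding isomorphic_to_NF_def by blast
  have img: "\<phi> x \<in> A" if "x \<in> NF_carrier n" for x
    using that bij by (auto simp: bij_betw_def)
  \<comment> \<open>For \<open>n = 0\<close> this is the zero vector, whereas \<open>NF_basis 1\<close> lies outside the carrier.\<close>
  define b :: "nat \<Rightarrow> 'f" where "b = (\<lambda>k. if k = 1 \<and> 1 \<le> n then 1 else 0)"
  have b: "b \<in> NF_carrier n" by (auto simp: b_def NF_carrier_def)
  have "\<exists>c. \<exists>u\<in>bracket_space A A. a = scale c (\<phi> b) + u" if "a \<in> A" for a
  proof -
    obtain x where x: "x \<in> NF_carrier n" "a = \<phi> x" using \<open>a \<in> A\<close> bij by (auto simp: bij_betw_def)
    \<comment> \<open>Shifting \<open>x\<close> down by one index makes the product of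
      \<open>y\<close> with \<open>b\<close> restore the coordinates of \<open>x\<close> from 2 to
      \<open>n\<close>.\<close>
    define y where "y = (\<lambda>k. if k \<in> {1..n} then x (k + 1) else 0)"
    have y: "y \<in> NF_carrier n" by (auto simp: y_def NF_carrier_def)
    have xb: "(\<lambda>k. x 1 * b k) \<in> NF_carrier n" and yb: "NF_bracket n y b \<in> NF_carrier n"
      using b by (auto simp: NF_carrier_def NF_bracket_def)
    have "x = (\<lambda>k. x 1 * b k + NF_bracket n y b k)"
    proof
      fix k
      consider "k = 0" | "k = 1" | "k \<in> {2..n}" | "k > n" "k \<noteq> 1" by force
      then show "x k = x 1 * b k + NF_bracket n y b k"
        using x(1) by cases (auto simp: NF_carrier_def NF_bracket_def b_def y_def)
    qed
    then have "a = scale (x 1) (\<phi> b) + br (\<phi> y) (\<phi> b)"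
      using add[OF xb yb] scale[OF b] br[OF y b] x(2) by simp
    then show ?thesis using br_in_bracket_space[OF img[OF y] img[OF b]] by blast
  qed
  then show thesis using that[OF img[OF b]] by blast
qed

end

theorem corollary3p4:
  fixes scale :: "'f::field_char_0 \<Rightarrow> 'a::ab_group_add \<Rightarrow> 'a"
    and br :: "'a \<Rightarrow> 'a \<Rightarrow> 'a"
    and N :: "'a set"
    and n :: nat
  assumes "leibniz_algebra scale br"
    and "\<exists>B. finite_dimensional_vector_space scale B"
    and "leibniz_algebra.solvable scale br UNIV"
    and "\<not> leibniz_algebra.nilpotent scale br UNIV"
    and "leibniz_algebra.is_nilradical scale br N"
    and "leibniz_algebra.isomorphic_to_NF scale br n N"
  shows "vector_space.dim scale (UNIV :: 'a set) = n + 1"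
proof -
  interpret leibniz_algebra scale br by (rule assms(1))
  obtain B where "finite_dimensional_vector_space scale B" using assms(2) by blast
  then interpret finite_dimensional_vector_space scale B .
  have N: "subspace N" "nilpotent N"
    using assms(5) by (auto simp: is_nilradical_def ideal_subspace)
  \<comment> \<open>Non-nilpotency enters here: the nilpotent ideal \<open>N\<close> cannot be the
    whole algebra.\<close>
  obtain x where x: "x \<notin> N" using N(2) assms(4) by (metis UNIV_eq_I)
  obtain e where "e \<in> N" "\<And>a. a \<in> N \<Longrightarrow> \<exists>c. \<exists>u\<in>bracket_space N N. a = scale c e + u"
    using NF_cyclic_mod_bracket_space[OF assms(6)] by blast
  then have "span (insert x N) = UNIV"
    by (rule nilradical_codim_le_1[OF assms(3,5) _ _ x])
  then have "dim UNIV = dim (insert x N)" by (metis dim_span)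
  also have "\<dots> = dim N + 1" using x N(1) by (metis dim_insert span_eq_iff)
  finally show ?thesis by (simp add: dim_NF[OF assms(6) N(1)])
qed

end
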